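(* Let $n \in \{1,2\}$. For every $c \in \mathbb{N}$ and every real $\epsilon > 0$ there exists $k \in \mathbb{N}$ such that $P[A^{n}_{k,c}] > 1 - \epsilon$, where $A^{n}_{k,c}$ is the event that the drunk angel of power $c$ on the $n$-dimensional infinite grid is caged when the hiding devil plays the Gauss's circle strategy with inner radius $k$.
   Context: The $n$-dimensional infinite grid has vertex set $\mathbb{Z}^n$. For $x=(x_1,\dots,x_n)$ let $\|x\| = \max_i |x_i|$ and $d(x,y)=\|x-y\|$. The lattice sphere of radius $r$ is $L^n_r = \{x \in \mathbb{Z}^n : \|x\| \le r\}$, and the hollow lattice sphere of inner radius $k$ and thickness $c$ is $H^n_{k,c} = L^n_{k+c} \setminus L^n_{k-1}$. The drunk angel of power $c$ starts at the origin and in each turn moves from her current vertex $x$ to each vertex $y$ with $d(x,y)\le c$ with probability $\frac{1}{(2c+1)^n}$, independently of previous turns (so her position is a sum of i.i.d. steps uniform on $\{-c,\dots,c\}^n$). Gauss's circle strategy: the hiding devil secretly destroys one vertex per turn for $N = |H^n_{k,c}|$ turns, building the closed shape $H^n_{k,c}$; destroyed vertices do not affect the angel's moves. After the angel's $N$-th move the devil reveals $H^n_{k,c}$, and $A^n_{k,c}$ is the event that the angel's position then lies in the inner part of $H^n_{k,c}$ (the region it encloses, i.e. points at distance less than $k$ from the origin). *)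

theory Defs
  imports "HOL-Probability.Probability"
begin

text \<open>The n-dimensional grid is \<^typ>\<open>int ^ 'n\<close>, with n the cardinality of the finite type 'n.\<close>

definition grid_norm :: "int ^ 'n \<Rightarrow> int" where
  "grid_norm x = Max (range (\<lambda>i. \<bar>x $ i\<bar>))"

definition grid_dist :: "int ^ 'n \<Rightarrow> int ^ 'n \<Rightarrow> int" where
  "grid_dist x y = grid_norm (x - y)"

text \<open>The radius is an integer, so that the removed ball of radius k - 1 is empty for k = 0.\<close>

definition lattice_sphere :: "int \<Rightarrow> (int ^ 'n) set" where
  "lattice_sphere r = {x. grid_norm x \<le> r}"

definition hollow_sphere :: "nat \<Rightarrow> nat \<Rightarrow> (int ^ 'n) set" where
  "hollow_sphere k c = lattice_sphere (int k + int c) - lattice_sphere (int k - 1)"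

definition inner_part :: "nat \<Rightarrow> (int ^ 'n) set" where
  "inner_part k = {x. grid_dist x 0 < int k}"

definition angel_move :: "nat \<Rightarrow> int ^ 'n \<Rightarrow> (int ^ 'n) pmf" where
  "angel_move c x = pmf_of_set {y. grid_dist x y \<le> int c}"

text \<open>
  Distribution of the history of the first t turns: a list of length t + 1 whose entry at index j
  is the position after the j-th move. Destroyed vertices do not influence the moves.
\<close>

primrec angel_walk :: "nat \<Rightarrow> nat \<Rightarrow> (int ^ 'n) list pmf" where
  "angel_walk c 0 = return_pmf [0]"
| "angel_walk c (Suc t) =
     bind_pmf (angel_walk c t) (\<lambda>xs. map_pmf (\<lambda>y. xs @ [y]) (angel_move c (last xs)))"

text \<open>
  The devil needs one turn per vertex of the hollow sphere; the angel is caged if after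
  that many moves she is in the inner part.
\<close>

definition caged :: "nat \<Rightarrow> nat \<Rightarrow> (int ^ 'n) list set" where
  "caged k c = {xs. xs ! card (hollow_sphere k c :: (int ^ 'n) set) \<in> inner_part k}"

lemma grid_norm_le_iff: "grid_norm (x :: int ^ 'n) \<le> r \<longleftrightarrow> (\<forall>i. \<bar>x $ i\<bar> \<le> r)"
  by (auto simp: grid_norm_def)

lemma grid_ball_image:
  "{y. grid_dist (x :: int ^ 'n) y \<le> r} = vec_lambda ` (\<Pi>\<^sub>E i\<in>UNIV. {x $ i - r..x $ i + r})"
proof (intro equalityI subsetI)
  fix y assume "y \<in> {y. grid_dist x y \<le> r}"
  then have "vec_nth y \<in> (\<Pi>\<^sub>E i\<in>UNIV. {x $ i - r..x $ i + r})"
    by (auto simp: grid_dist_def grid_norm_le_iff abs_le_iff algebra_simps)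
  then show "y \<in> vec_lambda ` (\<Pi>\<^sub>E i\<in>UNIV. {x $ i - r..x $ i + r})"
    by (metis image_eqI vec_nth_inverse)
qed (auto simp: grid_dist_def grid_norm_le_iff abs_le_iff PiE_iff algebra_simps)

lemma finite_grid_ball: "finite {y. grid_dist (x :: int ^ 'n) y \<le> r}"
  by (simp add: grid_ball_image finite_PiE)

lemma card_grid_ball: "card {y. grid_dist (x :: int ^ 'n) y \<le> int c} = (2 * c + 1) ^ CARD('n)"
proof -
  have "inj_on vec_lambda (\<Pi>\<^sub>E i\<in>UNIV. {x $ i - int c..x $ i + int c})"
    by (auto simp: inj_on_def vec_lambda_inject)
  moreover have "nat (1 + int c * 2) = 2 * c + 1" by simp
  ultimately show ?thesis
    by (simp add: grid_ball_image card_image card_PiE algebra_simps nat_add_distrib)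
qed

lemma pmf_angel_move:
  "pmf (angel_move c (x :: int ^ 'n)) y =
     (if grid_dist x y \<le> int c then 1 / (2 * real c + 1) ^ CARD('n) else 0)"
proof -
  have "card {y. grid_dist x y \<le> int c} \<noteq> 0"
    by (simp only: card_grid_ball) simp
  then have "{y. grid_dist x y \<le> int c} \<noteq> {}"
    by fastforce
  then show ?thesis
    unfolding angel_move_def
    by (simp add: pmf_of_set finite_grid_ball card_grid_ball indicator_def add_ac)
qed

lemma finite_hollow_sphere: "finite (hollow_sphere k c :: (int ^ 'n) set)"
proof -
  have "hollow_sphere k c \<subseteq> {y :: int ^ 'n. grid_dist 0 y \<le> int k + int c}"
    by (auto simp: hollow_sphere_def lattice_sphere_def grid_dist_def grid_norm_le_iff)
  then show ?thesis
    using finite_grid_ball finite_subset by blast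
qed

end

theory Submission
  imports Defs
begin

text \<open>
  Each coordinate of the walk has second moment at most \<open>t c\<^sup>2\<close> after \<open>t\<close> moves, since the steps
  are centred and bounded by \<open>c\<close>. By Chebyshev's inequality and a union bound over the
  coordinates, the angel is outside the inner part after \<open>t\<close> moves with probability at most
  \<open>n t c\<^sup>2 / k\<^sup>2\<close>. For \<open>n \<le> 2\<close> the hollow sphere has only \<open>O(k)\<close> vertices, so for \<open>t\<close> equal to
  their number this bound is \<open>O(1 / k)\<close>.
\<close>

lemma grid_dist_zero_left: "grid_dist 0 x = grid_norm x"
  and grid_dist_zero_right: "grid_dist x 0 = grid_norm x"
  by (simp_all add: grid_dist_def grid_norm_def)

lemma set_pmf_angel_move:
  "set_pmf (angel_move c (x :: int ^ 'n)) = {y. grid_dist x y \<le> int c}"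
proof -
  have "x \<in> {y. grid_dist x y \<le> int c}"
    by (simp add: grid_dist_def grid_norm_le_iff)
  then show ?thesis
    unfolding angel_move_def by (intro set_pmf_of_set finite_grid_ball) auto
qed

text \<open>The ball around \<open>x\<close> is symmetric about \<open>x\<close>, and a bijection of
  a finite set preserves its uniform distribution. This symmetry expresses that a step is centred,
  without computing any mean.\<close>

lemma map_reflect_angel_move:
  "map_pmf (\<lambda>y. 2 * x - y) (angel_move c (x :: int ^ 'n)) = angel_move c x"
proof -
  have "{y. grid_dist x y \<le> int c} \<noteq> {}"
    using set_pmf_not_empty[of "angel_move c x"] by (simp add: set_pmf_angel_move)
  moreover have "(\<lambda>y. 2 * x - y) ` {y. grid_dist x y \<le> int c} = {y. grid_dist x y \<le> int c}"
  proof -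
    have refl: "grid_dist x (2 * x - y) = grid_dist x y" for y
      by (simp add: grid_dist_def grid_norm_def abs_minus_commute)
    have "y \<in> (\<lambda>y. 2 * x - y) ` {y. grid_dist x y \<le> int c}" if "grid_dist x y \<le> int c" for y
      using that by (intro image_eqI[of _ _ "2 * x - y"]) (simp_all add: refl)
    then show ?thesis
      by (auto simp: refl)
  qed
  ultimately show ?thesis
    unfolding angel_move_def
    by (subst map_pmf_of_set_inj) (auto simp: finite_grid_ball inj_on_def)
qed

lemma angel_move_second_moment_le:
  "(\<integral>\<^sup>+y. ennreal ((real_of_int (y $ i))\<^sup>2) \<partial>measure_pmf (angel_move c (x :: int ^ 'n)))
     \<le> ennreal ((real_of_int (x $ i))\<^sup>2) + ennreal ((real c)\<^sup>2)"
proof -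
  let ?M = "measure_pmf (angel_move c x)"
  let ?f = "\<lambda>y :: int ^ 'n. (real_of_int (y $ i))\<^sup>2"
  have int: "integrable ?M g" for g :: "int ^ 'n \<Rightarrow> real"
    by (intro integrable_measure_pmf_finite) (simp add: set_pmf_angel_move finite_grid_ball)
  have "(\<integral>y. ?f y \<partial>?M) = (\<integral>y. ?f (2 * x - y) \<partial>?M)"
    by (subst map_reflect_angel_move[symmetric]) simp
  \<comment> \<open>Averaging over the reflection at \<open>x\<close> cancels the cross term.\<close>
  then have "2 * (\<integral>y. ?f y \<partial>?M) = (\<integral>y. ?f y + ?f (2 * x - y) \<partial>?M)"
    by (simp add: int)
  also have "\<dots> \<le> (\<integral>y. 2 * (?f x + (real c)\<^sup>2) \<partial>?M)"
  proof (intro integral_mono_AE int AE_pmfI)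
    fix y assume "y \<in> set_pmf (angel_move c x)"
    then have "\<bar>x $ i - y $ i\<bar> \<le> int c"
      by (simp add: set_pmf_angel_move grid_dist_def grid_norm_le_iff)
    then have "\<bar>real_of_int (x $ i) - real_of_int (y $ i)\<bar> \<le> real c"
      by linarith
    then have "(real_of_int (x $ i) - real_of_int (y $ i))\<^sup>2 \<le> (real c)\<^sup>2"
      by (simp add: abs_le_square_iff[symmetric])
    \<comment> \<open>With \<open>a = x $ i\<close> and \<open>b = y $ i\<close>, the left side is
      \<open>b^2 + (2*a - b)^2 = 2*a^2 + 2*(a - b)^2\<close>.\<close>
    then show "?f y + ?f (2 * x - y) \<le> 2 * (?f x + (real c)\<^sup>2)"
      by (simp add: power2_eq_square algebra_simps)
  qed
  finally have "(\<integral>y. ?f y \<partial>?M) \<le> ?f x + (real c)\<^sup>2"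
    by simp
  then have "(\<integral>\<^sup>+y. ennreal (?f y) \<partial>?M) \<le> ennreal (?f x + (real c)\<^sup>2)"
    by (subst nn_integral_eq_integral) (auto intro!: int ennreal_leI simp del: ennreal_plus)
  then show ?thesis
    by simp
qed

lemma length_angel_walk:
  "xs \<in> set_pmf (angel_walk c t :: (int ^ 'n) list pmf) \<Longrightarrow> length xs = Suc t"
  by (induction t arbitrary: xs) auto

text \<open>Each move adds at most \<open>c^2\<close>, whatever the current position. The
  nonnegative integral lets the induction pass through \<open>bind_pmf\<close> before integrability
  is known; the finite bound then yields integrability.\<close>

lemma angel_walk_second_moment_le:
  "(\<integral>\<^sup>+xs. ennreal ((real_of_int (last xs $ i))\<^sup>2)
      \<partial>measure_pmf (angel_walk c t :: (int ^ 'n) list pmf)) \<le> ennreal (real t * (real c)\<^sup>2)"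
proof (induction t)
  case (Suc t)
  let ?W = "angel_walk c t :: (int ^ 'n) list pmf"
  have "(\<integral>\<^sup>+xs. ennreal ((real_of_int (last xs $ i))\<^sup>2)
        \<partial>measure_pmf (angel_walk c (Suc t) :: (int ^ 'n) list pmf))
      = (\<integral>\<^sup>+xs. (\<integral>\<^sup>+y. ennreal ((real_of_int (y $ i))\<^sup>2) \<partial>angel_move c (last xs)) \<partial>?W)"
    by simp
  also have "\<dots> \<le> (\<integral>\<^sup>+xs. ennreal ((real_of_int (last xs $ i))\<^sup>2) + ennreal ((real c)\<^sup>2) \<partial>?W)"
    by (intro nn_integral_mono angel_move_second_moment_le)
  also have "\<dots> = (\<integral>\<^sup>+xs. ennreal ((real_of_int (last xs $ i))\<^sup>2) \<partial>?W) + ennreal ((real c)\<^sup>2)"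
    by (subst nn_integral_add) simp_all
  also have "\<dots> \<le> ennreal (real t * (real c)\<^sup>2) + ennreal ((real c)\<^sup>2)"
    by (intro add_right_mono Suc.IH)
  also have "\<dots> = ennreal (real (Suc t) * (real c)\<^sup>2)"
    by (simp add: ennreal_plus[symmetric] algebra_simps del: ennreal_plus)
  finally show ?case .
qed simp

text \<open>Chebyshev's inequality about the origin: Markov's inequality for the squared
  coordinate.\<close>

lemma prob_coordinate_ge_le:
  assumes "k > 0"
  shows "measure_pmf.prob (angel_walk c t :: (int ^ 'n) list pmf) {xs. \<bar>last xs $ i\<bar> \<ge> int k}
     \<le> real t * (real c)\<^sup>2 / (real k)\<^sup>2"
proof -
  let ?W = "angel_walk c t :: (int ^ 'n) list pmf"
  let ?f = "\<lambda>xs :: (int ^ 'n) list. (real_of_int (last xs $ i))\<^sup>2"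
  have fin: "(\<integral>\<^sup>+xs. ennreal (?f xs) \<partial>?W) \<noteq> \<infinity>"
    using angel_walk_second_moment_le[of c t i] by (auto simp: top_unique)
  then have int: "integrable ?W ?f"
    by (intro integrableI_nonneg) (auto simp: less_top)
  have ev: "{xs. \<bar>last xs $ i\<bar> \<ge> int k} = {xs. ?f xs \<ge> (real k)\<^sup>2}"
  proof -
    have "\<bar>z\<bar> \<ge> int k \<longleftrightarrow> (real_of_int z)\<^sup>2 \<ge> (real k)\<^sup>2" for z
      by (simp add: abs_le_square_iff[symmetric]) linarith
    then show ?thesis by auto
  qed
  have "measure ?W {xs \<in> space ?W. ?f xs \<ge> (real k)\<^sup>2} \<le> (\<integral>xs. ?f xs \<partial>?W) / (real k)\<^sup>2"
    using assms by (intro integral_Markov_inequality_measure[where A = UNIV] int) auto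
  also have "(\<integral>xs. ?f xs \<partial>?W) \<le> real t * (real c)\<^sup>2"
    using angel_walk_second_moment_le[of c t i] nn_integral_eq_integral[OF int] by simp
  finally show ?thesis
    by (simp add: ev divide_right_mono)
qed

lemma prob_angel_walk_outside_le:
  assumes "k > 0"
  shows "measure_pmf.prob (angel_walk c t :: (int ^ 'n) list pmf) {xs. xs ! t \<notin> inner_part k}
     \<le> real CARD('n) * (real t * (real c)\<^sup>2 / (real k)\<^sup>2)"
proof -
  let ?W = "angel_walk c t :: (int ^ 'n) list pmf"
  have "measure_pmf.prob ?W {xs. xs ! t \<notin> inner_part k}
      \<le> measure_pmf.prob ?W (\<Union>i. {xs. \<bar>last xs $ i\<bar> \<ge> int k})"
  proof (intro measure_pmf.finite_measure_mono_AE AE_pmfI impI)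
    fix xs assume xs: "xs \<in> set_pmf ?W" and "xs \<in> {xs. xs ! t \<notin> inner_part k}"
    \<comment> \<open>A history of \<open>t\<close> moves also records the start, so index
      \<open>t\<close> is its last entry.\<close>
    moreover have "last xs = xs ! t"
      using length_angel_walk[OF xs] by (subst last_conv_nth) auto
    ultimately have "\<not> grid_norm (last xs) \<le> int k - 1"
      by (simp add: inner_part_def grid_dist_zero_right)
    then obtain i where "\<not> \<bar>last xs $ i\<bar> \<le> int k - 1"
      unfolding grid_norm_le_iff by blast
    then have "\<bar>last xs $ i\<bar> \<ge> int k"
      by linarith
    then show "xs \<in> (\<Union>i. {xs. \<bar>last xs $ i\<bar> \<ge> int k})"
      by blast
  qed simp
  also have "\<dots> \<le> (\<Sum>i\<in>UNIV. measure_pmf.prob ?W {xs. \<bar>last xs $ i\<bar> \<ge> int k})"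
    by (intro measure_pmf.finite_measure_subadditive_finite) auto
  also have "\<dots> \<le> (\<Sum>i\<in>(UNIV :: 'n set). real t * (real c)\<^sup>2 / (real k)\<^sup>2)"
    by (intro sum_mono prob_coordinate_ge_le assms)
  finally show ?thesis by simp
qed

text \<open>For \<open>k > 0\<close> the radius \<open>k - 1\<close> is a genuine natural number, so
  both spheres are balls to which \<open>card_grid_ball\<close> applies.\<close>

lemma card_hollow_sphere:
  assumes "k > 0"
  shows "card (hollow_sphere k c :: (int ^ 'n) set)
     = (2 * (k + c) + 1) ^ CARD('n) - (2 * (k - 1) + 1) ^ CARD('n)"
proof -
  have sphere: "lattice_sphere (int r) = {y :: int ^ 'n. grid_dist 0 y \<le> int r}" for r
    by (simp add: lattice_sphere_def grid_dist_zero_left)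
  have "hollow_sphere k c
      = (lattice_sphere (int (k + c)) - lattice_sphere (int (k - 1)) :: (int ^ 'n) set)"
    using assms by (simp add: hollow_sphere_def of_nat_diff)
  also have "card \<dots> = card (lattice_sphere (int (k + c)) :: (int ^ 'n) set)
      - card (lattice_sphere (int (k - 1)) :: (int ^ 'n) set)"
  proof (intro card_Diff_subset)
    show "finite (lattice_sphere (int (k - 1)) :: (int ^ 'n) set)"
      by (simp only: sphere finite_grid_ball)
  qed (auto simp: lattice_sphere_def)
  finally show ?thesis
    by (simp only: sphere card_grid_ball)
qed

text \<open>The exact count is \<open>2*c + 2\<close> in dimension 1 and
  \<open>(2*c + 2) * (4*k + 2*c)\<close> in dimension 2. Both obey the bound since
  \<open>k \<ge> 1\<close>. Linear growth in \<open>k\<close> is what the final estimate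
  needs.\<close>

lemma card_hollow_sphere_le:
  assumes "CARD('n) \<in> {1, 2}" and "k > 0"
  shows "card (hollow_sphere k c :: (int ^ 'n) set) \<le> (2 * c + 2) * (2 * c + 4) * k"
proof -
  \<comment> \<open>Writing \<open>k\<close> as a successor removes the truncated subtraction
    \<open>k - 1\<close>.\<close>
  obtain m where k: "k = Suc m" using assms(2) gr0_implies_Suc by blast
  from assms(1) show ?thesis
    by (auto simp: card_hollow_sphere k power2_eq_square algebra_simps)
qed

theorem theorem2:
  fixes c :: nat and \<epsilon> :: real
  assumes "CARD('n::finite) \<in> {1, 2}" and "\<epsilon> > 0"
  shows "\<exists>k::nat. measure_pmf.prob
           (angel_walk c (card (hollow_sphere k c :: (int ^ 'n) set)))
           (caged k c :: (int ^ 'n) list set) > 1 - \<epsilon>"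
proof -
  \<comment> \<open>\<open>K / k\<close> will bound the escape probability: 2 bounds the dimension,
    the product of the two sums is the number of turns per unit of \<open>k\<close>, and
    \<open>c^2\<close> is the second moment gained per turn.\<close>
  define K where "K = 2 * (real ((2 * c + 2) * (2 * c + 4)) * (real c)\<^sup>2)"
  have "K \<ge> 0" by (simp add: K_def)
  obtain k :: nat where k: "real k > K / \<epsilon>"
    using reals_Archimedean2 by blast
  with \<open>K \<ge> 0\<close> \<open>\<epsilon> > 0\<close> have "k > 0"
    by (metis divide_nonneg_pos le_less_trans of_nat_0_less_iff)
  define N where "N = card (hollow_sphere k c :: (int ^ 'n) set)"
  let ?W = "angel_walk c N :: (int ^ 'n) list pmf"
  have caged: "- caged k c = {xs :: (int ^ 'n) list. xs ! N \<notin> inner_part k}"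
    by (auto simp: caged_def N_def)
  have "measure_pmf.prob ?W (- caged k c) \<le> real CARD('n) * (real N * (real c)\<^sup>2 / (real k)\<^sup>2)"
    unfolding caged using \<open>k > 0\<close> by (rule prob_angel_walk_outside_le)
  also have "\<dots> \<le> 2 * (real ((2 * c + 2) * (2 * c + 4) * k) * (real c)\<^sup>2 / (real k)\<^sup>2)"
  proof (intro mult_mono divide_right_mono mult_right_mono)
    show "real N \<le> real ((2 * c + 2) * (2 * c + 4) * k)"
      unfolding N_def of_nat_le_iff by (rule card_hollow_sphere_le[OF assms(1) \<open>k > 0\<close>])
  qed (use assms(1) in auto)
  \<comment> \<open>The factor \<open>k\<close> from the number of turns cancels only one of the two
    in the denominator.\<close>
  also have "\<dots> = K / real k"
    using \<open>k > 0\<close> by (simp add: K_def power2_eq_square field_simps)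
  also have "\<dots> < \<epsilon>"
    using k \<open>k > 0\<close> \<open>\<epsilon> > 0\<close> by (simp add: field_simps)
  finally have "measure_pmf.prob ?W (caged k c) > 1 - \<epsilon>"
    using measure_pmf.prob_compl[of "caged k c" ?W] by (simp add: Compl_eq_Diff_UNIV)
  then show ?thesis
    unfolding N_def by blast
qed

end
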